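(* Let $g$ be a 1-stranded SCA pattern. Then $g$ is a repeating SCA pattern if and only if $g$ is a shift of one of the following: 1. $([[s,n],[n,s]])^\infty$, which has speed $0$ and generic turning rule $X0X00XXXX$; 2. $([[r,n]])^\infty$, which has speed $-1$ and generic turning rule $XXXX0XX1X$; 3. $([[n,s],[r,n],[s,n]])^\infty$, which has speed $-\frac13$ and generic turning rule $X1X00XX0X$; 4. $([[n,l]])^\infty$, which has speed $1$ and generic turning rule $XXXX01XXX$; 5. $([[s,n],[n,l],[n,s]])^\infty$, which has speed $\frac13$ and generic turning rule $X0X100XXX$; 6. $([[s,n],[n,l],[n,s],[r,n]])^\infty$, which has speed $0$ and generic turning rule $X1X100X0X$. (In each list the comma-separated entries are successive generations, each consisting of a single nonempty cell.)
   Context: **Cells.** A cell has a left and a right slot and is of one of eight types: $[n,n]$ (empty); $[s,n]$, $[n,s]$, $[s,s]$; $[r,n]$; $[n,l]$; $[r,l]$ (a Z-crossing); $\overline{[r,l]}$ (an S-crossing). The symbols $s,r,l$ are strands (straight, turning right, turning left); $n$ means no strand. A cell has state E if it is empty, S if it contains an $s$, T if it contains an $r$ or an $l$. A strand exits its cell to the left if it is an $s$ in the left slot or an $l$; it exits to the right if it is an $s$ in the right slot or an $r$. **Generations.** A generation with $n$ strands is a map $\delta$ from $\mathbb Z$ to cell types containing exactly $n$ strands in total, with $\delta(0)$ nonempty and $\delta(j)$ empty for $j<0$ (so generations are recorded up to horizontal translation). It is written as the string of cells $\delta(0)\delta(1)\cdots\delta(m)$, where $\delta(m)$ is the last nonempty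 cell. Strand $k$ of $\delta$ is the $k$-th strand from the left. **Grid patterns.** An ($n$-stranded) grid pattern is a finite or infinite list $g=[\delta_1,\delta_2,\dots]$ of generations with $n$ strands. For consecutive generations $\delta,\delta'$, the child of the adjacent cells $\delta(k),\delta(k+1)$ is $\delta'(k+1)$ if some strand of $\delta(0)$ exits to the left, and $\delta'(k)$ otherwise. The pattern is continuous if for all consecutive generations $\delta,\delta'$ and all $k$, the child of $\delta(k),\delta(k+1)$ has its left slot occupied iff a strand of $\delta(k)$ exits to the right, and its right slot occupied iff a strand of $\delta(k+1)$ exits to the left. Composition of patterns is concatenation of lists; $a^\infty$ is $a$ repeated infinitely often. If $g$ is of the form $a^\infty$, $\operatorname{per}(g)$ is the shortest $a$ with $g=a^\infty$, and $|\operatorname{per}(g)|$ is its number of generations. **Rules.** A turning rule is a string $t=t_0t_1\cdots t_8\in\{0,1\}^9$ with $t_4=0$; the bits $0,1,\dots,8$ correspond in order to the pairs SS, SE, ST, ES, EE, ET, TS, TE, TT. It is a turning rule of a continuous pattern $g$ if, whenever adjacent cells $A,B$ (left, right) of a generation have a nonempty child $C$ in the next generation and the pair (state of $A$, state of $B$) corresponds to bit $i$, then $C$ has state T if $t_i=1$ and state S if $t_i=0$. A crossing rule assigns a bit (1 for Z-crossing, 0 for S-crossing) to each of the nine pairs of crossing statuses (none, Z, S) of $A,B$, and prescribes the type of any child that is a crossing; bit 4 (the fifth symbol) is the pair (none, none). An SCA pattern is a continuous grid pattern that has a turning rule and a crossing rule. The generic turning (crossing) rule of a pattern is the string over $\{0,1,X\}$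 with $X$ in the places where both values occur among the turning (crossing) rules of the pattern and otherwise the common value. **Speed.** For a generation $\delta$ put $e(\delta)=1$ if $\delta(0)=[n,l]$, $e(\delta)=-1$ if $\delta(0)=[r,n]$, and $e(\delta)=0$ otherwise. The speed of $g=a^\infty$ with $a=\operatorname{per}(g)$ is the symbol $\frac{d}{|a|}$ with $d=\sum_{\delta\in a}e(\delta)$ (a formal fraction, not reduced), except that $1,-1,0$ denote any $\frac aa,\frac{-a}{a},\frac0a$ respectively. **Repeating patterns and gliders.** A null chain in $a=[\delta_1,\dots,\delta_k]$ is a sequence of empty cells $C_1,\dots,C_k$, $C_i$ a cell of $\delta_i$, such that $\delta_1$ has nonempty cells both to the left and to the right of $C_1$, and each $C_{i+1}$ is the child of $C_i$ and one of its two horizontal neighbours. A repeating SCA pattern is an SCA pattern of the form $g=a^\infty$, $a=\operatorname{per}(g)$, such that $a$ has no null chain. A glider is a repeating SCA pattern of nonzero speed. A shift of $g$ is $b^\infty$ with $b$ a cyclic permutation of the list $\operatorname{per}(g)$. *)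

theory Defs
  imports Main "HOL-Library.Stream"
begin

datatype slot = N | S | R | L

(* C_rl is the Z-crossing [r,l]; C_rl_bar is the S-crossing, written [r,l] with an overline. *)
datatype cell = C_nn | C_sn | C_ns | C_ss | C_rn | C_nl | C_rl | C_rl_bar

primrec left_slot :: "cell \<Rightarrow> slot" where
  "left_slot C_nn = N"
| "left_slot C_sn = S"
| "left_slot C_ns = N"
| "left_slot C_ss = S"
| "left_slot C_rn = R"
| "left_slot C_nl = N"
| "left_slot C_rl = R"
| "left_slot C_rl_bar = R"

primrec right_slot :: "cell \<Rightarrow> slot" where
  "right_slot C_nn = N"
| "right_slot C_sn = N"
| "right_slot C_ns = S"
| "right_slot C_ss = S"
| "right_slot C_rn = N"
| "right_slot C_nl = L"
| "right_slot C_rl = L"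
| "right_slot C_rl_bar = L"

definition strands_in :: "cell \<Rightarrow> nat" where
  "strands_in c = (if left_slot c \<noteq> N then 1 else 0) + (if right_slot c \<noteq> N then 1 else 0)"

datatype state = St_E | St_S | St_T

definition state_of :: "cell \<Rightarrow> state" where
  "state_of c =
     (if c = C_nn then St_E
      else if left_slot c = S \<or> right_slot c = S then St_S
      else St_T)"

definition exits_left :: "cell \<Rightarrow> bool" where
  "exits_left c \<longleftrightarrow> left_slot c = S \<or> left_slot c = L \<or> right_slot c = L"

definition exits_right :: "cell \<Rightarrow> bool" where
  "exits_right c \<longleftrightarrow> right_slot c = S \<or> right_slot c = R \<or> left_slot c = R"

type_synonym generation = "int \<Rightarrow> cell"

definition is_generation :: "nat \<Rightarrow> generation \<Rightarrow> bool" where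
  "is_generation n \<delta> \<longleftrightarrow>
     finite {j. \<delta> j \<noteq> C_nn} \<and> (\<Sum>j | \<delta> j \<noteq> C_nn. strands_in (\<delta> j)) = n \<and>
     \<delta> 0 \<noteq> C_nn \<and> (\<forall>j<0. \<delta> j = C_nn)"

definition cells :: "cell list \<Rightarrow> generation" where
  "cells cs = (\<lambda>j. if 0 \<le> j \<and> j < int (length cs) then cs ! nat j else C_nn)"

datatype pattern = Finite "generation list" | Infinite "generation stream"

(* a^infinity; only meaningful for nonempty a *)
definition omega :: "generation list \<Rightarrow> pattern" where
  "omega a = Infinite (cycle a)"

primrec generations :: "pattern \<Rightarrow> generation set" where
  "generations (Finite ds) = set ds"
| "generations (Infinite ds) = sset ds"

primrec consecutive :: "pattern \<Rightarrow> generation \<Rightarrow> generation \<Rightarrow> bool" where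
  "consecutive (Finite ds) \<delta> \<delta>' \<longleftrightarrow> (\<exists>i. Suc i < length ds \<and> \<delta> = ds ! i \<and> \<delta>' = ds ! Suc i)"
| "consecutive (Infinite ds) \<delta> \<delta>' \<longleftrightarrow> (\<exists>i. \<delta> = ds !! i \<and> \<delta>' = ds !! Suc i)"

definition grid_pattern :: "nat \<Rightarrow> pattern \<Rightarrow> bool" where
  "grid_pattern n g \<longleftrightarrow> (\<forall>\<delta>\<in>generations g. is_generation n \<delta>)"

(* index, in the next generation, of the child of the cells at k and k + 1 *)
definition child_pos :: "generation \<Rightarrow> int \<Rightarrow> int" where
  "child_pos \<delta> k = (if exits_left (\<delta> 0) then k + 1 else k)"

definition child :: "generation \<Rightarrow> generation \<Rightarrow> int \<Rightarrow> cell" where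
  "child \<delta> \<delta>' k = \<delta>' (child_pos \<delta> k)"

definition continuous :: "pattern \<Rightarrow> bool" where
  "continuous g \<longleftrightarrow>
     (\<forall>\<delta> \<delta>' k. consecutive g \<delta> \<delta>' \<longrightarrow>
        (left_slot (child \<delta> \<delta>' k) \<noteq> N \<longleftrightarrow> exits_right (\<delta> k)) \<and>
        (right_slot (child \<delta> \<delta>' k) \<noteq> N \<longleftrightarrow> exits_left (\<delta> (k + 1))))"

fun rule_bit :: "state \<Rightarrow> state \<Rightarrow> nat" where
  "rule_bit St_S St_S = 0"
| "rule_bit St_S St_E = 1"
| "rule_bit St_S St_T = 2"
| "rule_bit St_E St_S = 3"
| "rule_bit St_E St_E = 4"
| "rule_bit St_E St_T = 5"
| "rule_bit St_T St_S = 6"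
| "rule_bit St_T St_E = 7"
| "rule_bit St_T St_T = 8"

definition turning_rule :: "bool list \<Rightarrow> bool" where
  "turning_rule t \<longleftrightarrow> length t = 9 \<and> \<not> t ! 4"

definition has_turning_rule :: "pattern \<Rightarrow> bool list \<Rightarrow> bool" where
  "has_turning_rule g t \<longleftrightarrow>
     continuous g \<and> turning_rule t \<and>
     (\<forall>\<delta> \<delta>' k. consecutive g \<delta> \<delta>' \<longrightarrow> child \<delta> \<delta>' k \<noteq> C_nn \<longrightarrow>
        state_of (child \<delta> \<delta>' k) =
          (if t ! rule_bit (state_of (\<delta> k)) (state_of (\<delta> (k + 1))) then St_T else St_S))"

datatype crossing_status = No_crossing | Z_crossing | S_crossing

definition crossing_status_of :: "cell \<Rightarrow> crossing_status" where
  "crossing_status_of c =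
     (if c = C_rl then Z_crossing else if c = C_rl_bar then S_crossing else No_crossing)"

type_synonym crossing_rule = "crossing_status \<Rightarrow> crossing_status \<Rightarrow> bool"

definition has_crossing_rule :: "pattern \<Rightarrow> crossing_rule \<Rightarrow> bool" where
  "has_crossing_rule g c \<longleftrightarrow>
     continuous g \<and>
     (\<forall>\<delta> \<delta>' k. consecutive g \<delta> \<delta>' \<longrightarrow> crossing_status_of (child \<delta> \<delta>' k) \<noteq> No_crossing \<longrightarrow>
        crossing_status_of (child \<delta> \<delta>' k) =
          (if c (crossing_status_of (\<delta> k)) (crossing_status_of (\<delta> (k + 1)))
           then Z_crossing else S_crossing))"

definition sca_pattern :: "nat \<Rightarrow> pattern \<Rightarrow> bool" where
  "sca_pattern n g \<longleftrightarrow>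
     grid_pattern n g \<and> continuous g \<and>
     (\<exists>t. has_turning_rule g t) \<and> (\<exists>c. has_crossing_rule g c)"

datatype rule_symbol = B0 | B1 | X

(* The common value is only meaningful when g has at least one turning rule. *)
definition generic_turning_rule :: "pattern \<Rightarrow> rule_symbol list" where
  "generic_turning_rule g =
     map (\<lambda>i. if \<exists>t u. has_turning_rule g t \<and> has_turning_rule g u \<and> t ! i \<noteq> u ! i then X
              else if \<forall>t. has_turning_rule g t \<longrightarrow> t ! i then B1
              else B0) [0..<9]"

definition is_omega :: "pattern \<Rightarrow> bool" where
  "is_omega g \<longleftrightarrow> (\<exists>a. a \<noteq> [] \<and> g = omega a)"

definition per :: "pattern \<Rightarrow> generation list" where
  "per g = arg_min length (\<lambda>a. a \<noteq> [] \<and> g = omega a)"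

(* Formal, unreduced fractions, except that all a/a, all (-a)/a and all 0/a are identified. *)
datatype speed = Speed_1 | Speed_minus_1 | Speed_0 | Frac int nat

definition speed_symbol :: "int \<Rightarrow> nat \<Rightarrow> speed" where
  "speed_symbol d m =
     (if d = int m then Speed_1
      else if d = - int m then Speed_minus_1
      else if d = 0 then Speed_0
      else Frac d m)"

definition edge_move :: "generation \<Rightarrow> int" where
  "edge_move \<delta> = (if \<delta> 0 = C_nl then 1 else if \<delta> 0 = C_rn then - 1 else 0)"

definition speed :: "pattern \<Rightarrow> speed" where
  "speed g = speed_symbol (\<Sum>\<delta>\<leftarrow>per g. edge_move \<delta>) (length (per g))"

(* ps lists the positions of the cells of the chain.  The child of a cell and its left (right)
   neighbour is the child of the cells at p - 1, p (at p, p + 1). *)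
definition null_chain :: "generation list \<Rightarrow> int list \<Rightarrow> bool" where
  "null_chain a ps \<longleftrightarrow>
     a \<noteq> [] \<and> length ps = length a \<and>
     (\<forall>i<length a. (a ! i) (ps ! i) = C_nn) \<and>
     (\<exists>j < ps ! 0. (a ! 0) j \<noteq> C_nn) \<and> (\<exists>j > ps ! 0. (a ! 0) j \<noteq> C_nn) \<and>
     (\<forall>i. Suc i < length a \<longrightarrow>
        ps ! Suc i \<in> {child_pos (a ! i) (ps ! i - 1), child_pos (a ! i) (ps ! i)})"

definition repeating_sca_pattern :: "nat \<Rightarrow> pattern \<Rightarrow> bool" where
  "repeating_sca_pattern n g \<longleftrightarrow>
     sca_pattern n g \<and> is_omega g \<and> \<not> (\<exists>ps. null_chain (per g) ps)"

definition is_shift_of :: "pattern \<Rightarrow> pattern \<Rightarrow> bool" where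
  "is_shift_of h g \<longleftrightarrow> is_omega g \<and> (\<exists>k. h = omega (rotate k (per g)))"

end

theory Submission
  imports Defs
begin

text \<open>
  A generation with one strand is a single cell, which is one of \<open>C_sn\<close>, \<open>C_ns\<close>, \<open>C_rn\<close>,
  \<open>C_nl\<close>.  Its strand meets only empty cells, so only the bits SE, ES, ET and TE of a turning rule
  are ever consulted, and they make each generation a function of its predecessor.  A repeating
  pattern is therefore a cycle of a self-map of a four-element set, and there are only six such
  cycles.  Null chains need two nonempty cells in one generation and never occur.
\<close>

section \<open>Periodic streams and shortest periods\<close>

declare snth.simps [simp del]

lemma snth_equalityI: "(\<And>i. s !! i = s' !! i) \<Longrightarrow> s = s'"
  using smap_alt[of id s s'] by (simp add: stream.map_id)

lemma snth_cycle: "xs \<noteq> [] \<Longrightarrow> cycle xs !! i = xs ! (i mod length xs)"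
  using sdrop_simps(1)[of i "cycle xs"] by (simp add: sdrop_cycle hd_rotate_conv_nth)

lemma smap_cycle: "xs \<noteq> [] \<Longrightarrow> smap f (cycle xs) = cycle (map f xs)"
  by (rule snth_equalityI) (simp add: snth_cycle)

text \<open>A nonempty period is the initial segment of its stream of that length, so the length
  alone determines it. This makes the choice in \<open>per\<close> unambiguous.\<close>

lemma omega_inject_length:
  assumes "omega a = omega b" "a \<noteq> []" "b \<noteq> []" "length a = length b"
  shows "a = b"
proof (rule nth_equalityI)
  fix i assume "i < length a"
  then have "cycle a !! i = a ! i" "cycle b !! i = b ! i"
    using assms by (simp_all add: snth_cycle)
  then show "a ! i = b ! i"
    using assms(1) by (simp add: omega_def)
qed (use assms in simp)

lemma per_omega:
  assumes "is_omega g"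
  shows "per g \<noteq> []" "g = omega (per g)"
proof -
  obtain a where "a \<noteq> [] \<and> g = omega a"
    using assms by (auto simp: is_omega_def)
  then have "per g \<noteq> [] \<and> g = omega (per g)"
    unfolding per_def by (rule arg_min_natI)
  then show "per g \<noteq> []" "g = omega (per g)"
    by auto
qed

text \<open>If the shortest period \<open>?b\<close> were shorter than \<open>a\<close>, the entry
  of \<open>a\<close> at index \<open>length ?b\<close> would repeat its entry at index 0, against
  distinctness. So the lengths agree, and the two periods coincide.\<close>

lemma per_omega_distinct:
  assumes "a \<noteq> []" "distinct a"
  shows "per (omega a) = a"
proof -
  let ?b = "per (omega a)"
  have b: "?b \<noteq> []" "omega a = omega ?b"
    using assms per_omega[of "omega a"] by (auto simp: is_omega_def)
  have le: "length ?b \<le> length a"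
    unfolding per_def by (rule arg_min_nat_le) (use assms in auto)
  have "length ?b = length a"
  proof (rule ccontr)
    assume "length ?b \<noteq> length a"
    with le have lt: "length ?b < length a"
      by simp
    have "a ! length ?b = cycle ?b !! length ?b"
      using assms lt b by (metis mod_less omega_def pattern.inject(2) snth_cycle)
    also have "\<dots> = cycle ?b !! 0"
      using b by (simp add: snth_cycle)
    also have "\<dots> = a ! 0"
      using assms b by (metis mod_0 omega_def pattern.inject(2) snth_cycle)
    finally show False
      using assms lt b by (simp add: nth_eq_iff_index_eq)
  qed
  then show ?thesis
    using b assms omega_inject_length[of a ?b] by simp
qed

text \<open>An orbit that returns to its start is purely periodic. Cutting it at the first return
  time \<open>m\<close> gives a period without repeated entries.\<close>

lemma periodic_orbit_distinct_cycle:
  assumes step: "\<And>i. s !! Suc i = f (s !! i)"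
    and periodic: "0 < n" "s !! n = s !! 0"
  obtains xs where "xs \<noteq> []" "distinct xs" "s = cycle xs"
proof -
  define m where "m = (LEAST m. 0 < m \<and> s !! m = s !! 0)"
  have m: "0 < m" "s !! m = s !! 0"
    using LeastI[of "\<lambda>m. 0 < m \<and> s !! m = s !! 0" n] periodic by (auto simp: m_def)
  have least: "\<not> (0 < k \<and> s !! k = s !! 0)" if "k < m" for k
    using not_less_Least that unfolding m_def by blast
  have shift: "s !! (i + k) = s !! (j + k)" if "s !! i = s !! j" for i j k
    using that by (induction k) (simp_all add: step)
  have "i = j" if "i < m" "j < m" "s !! i = s !! j" for i j
    using that
  proof (induction i j rule: linorder_wlog)
    \<comment> \<open>Applying \<open>f\<close> another \<open>m - j\<close> times to equal entries
      at i and j leads from the latter to time m, hence back to the start. If i < j, the former gets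
      there at a positive time below m, against minimality.\<close>
    case (le i j)
    have "s !! (i + (m - j)) = s !! 0"
      using shift[of i j "m - j"] le m by simp
    then show ?case
      using least[of "i + (m - j)"] le by force
  qed auto
  then have "distinct (stake m s)"
    by (auto simp: distinct_conv_nth)
  moreover have "s !! i = s !! (i mod m)" for i
  proof (induction i rule: less_induct)
    case (less i)
    show ?case
    proof (cases "i < m")
      case False
      then have "s !! i = s !! (i - m)"
        using shift[of m 0 "i - m"] m by simp
      also have "\<dots> = s !! ((i - m) mod m)"
        using False m by (intro less) simp
      finally show ?thesis
        using False by (simp add: le_mod_geq)
    qed simp
  qed
  then have "s !! i = cycle (stake m s) !! i" for i
    using m by (subst snth_cycle) (auto simp flip: length_0_conv)
  then have "s = cycle (stake m s)"
    by (rule snth_equalityI)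
  moreover have "stake m s \<noteq> []"
    using m by (cases m) auto
  ultimately show thesis
    using that by blast
qed

section \<open>One-strand generations and their successors\<close>

definition single_strand_cells :: "cell set" where
  "single_strand_cells = {C_sn, C_ns, C_rn, C_nl}"

definition single :: "cell \<Rightarrow> generation" where
  "single c = cells [c]"

lemma single_apply: "single c j = (if j = 0 then c else C_nn)"
  by (auto simp: single_def cells_def)

lemma inj_single: "inj single"
  by (rule injI, drule fun_cong[of _ _ 0]) (simp add: single_apply)

text \<open>Each nonempty cell carries at least one strand, and cell 0 is nonempty. It therefore
  uses up the total of 1, and every other cell is empty.\<close>

lemma is_generation_1:
  assumes "is_generation 1 \<delta>"
  obtains c where "c \<in> single_strand_cells" "\<delta> = single c"
proof -
  let ?A = "{j. \<delta> j \<noteq> C_nn}"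
  have fin: "finite ?A" and sum: "(\<Sum>j\<in>?A. strands_in (\<delta> j)) = 1" and zero: "0 \<in> ?A"
    using assms by (auto simp: is_generation_def)
  have pos: "strands_in c \<ge> 1" if "c \<noteq> C_nn" for c
    using that by (cases c) (auto simp: strands_in_def)
  have split: "strands_in (\<delta> 0) + (\<Sum>j\<in>?A - {0}. strands_in (\<delta> j)) = 1"
    using sum.remove[OF fin zero, of "\<lambda>j. strands_in (\<delta> j)"] sum by simp
  then have "strands_in (\<delta> 0) = 1" and rest: "(\<Sum>j\<in>?A - {0}. strands_in (\<delta> j)) = 0"
    using pos[of "\<delta> 0"] zero by auto
  then have "\<delta> 0 \<in> single_strand_cells"
    by (cases "\<delta> 0") (auto simp: strands_in_def single_strand_cells_def)
  moreover have "\<delta> j = C_nn" if "j \<noteq> 0" for j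
  proof (rule ccontr)
    assume "\<delta> j \<noteq> C_nn"
    then show False
      using rest fin that pos[of "\<delta> j"] by simp
  qed
  then have "\<delta> = single (\<delta> 0)"
    by (auto simp: single_apply)
  ultimately show thesis
    using that by blast
qed

text \<open>The bits 3, 5, 1, 7 are ES, ET, SE, TE: a strand exiting left has an empty cell as the
  other parent on its left, one exiting right has it on its right. The value \<open>C_nn\<close> on
  the remaining cells is a dummy that makes the map total.\<close>

primrec step :: "bool list \<Rightarrow> cell \<Rightarrow> cell" where
  "step t C_sn = (if t ! 3 then C_nl else C_ns)"
| "step t C_nl = (if t ! 5 then C_nl else C_ns)"
| "step t C_ns = (if t ! 1 then C_rn else C_sn)"
| "step t C_rn = (if t ! 7 then C_rn else C_sn)"
| "step t C_nn = C_nn"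
| "step t C_ss = C_nn"
| "step t C_rl = C_nn"
| "step t C_rl_bar = C_nn"

text \<open>The left side joins the conditions of \<open>continuous\<close> and
  \<open>has_turning_rule\<close> for one pair of generations. Continuity decides which slot of the
  child holds the strand, and the turning bit decides whether it is straight or turning; together
  they fix the child.\<close>

lemma single_successor_iff:
  assumes "c \<in> single_strand_cells" "c' \<in> single_strand_cells" "turning_rule t"
  shows "(\<forall>k. (left_slot (child (single c) (single c') k) \<noteq> N \<longleftrightarrow> exits_right (single c k)) \<and>
              (right_slot (child (single c) (single c') k) \<noteq> N \<longleftrightarrow>
                 exits_left (single c (k + 1))) \<and>
              (child (single c) (single c') k \<noteq> C_nn \<longrightarrow>
                 state_of (child (single c) (single c') k) =
                   (if t ! rule_bit (state_of (single c k)) (state_of (single c (k + 1)))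
                    then St_T else St_S))) \<longleftrightarrow> c' = step t c"
    (is "(\<forall>k. ?P k) \<longleftrightarrow> _")
proof
  assume "\<forall>k. ?P k"
  \<comment> \<open>Only the pairs of positions (-1, 0) and (0, 1) contain the nonempty
    cell.\<close>
  then have "?P (- 1)" "?P 0"
    by blast+
  then show "c' = step t c"
    using assms
    by (auto simp: single_strand_cells_def single_apply child_def child_pos_def exits_left_def
        exits_right_def state_of_def split: if_splits)
next
  assume "c' = step t c"
  moreover have "?P k" if "c' = step t c" for k
    using assms(1,3) that unfolding single_strand_cells_def
    by (cases "k = 0"; cases "k = - 1"; elim insertE emptyE;
        simp add: single_apply child_def child_pos_def exits_left_def exits_right_def state_of_def
          turning_rule_def)
  ultimately show "\<forall>k. ?P k"
    by blast
qed

lemma has_turning_rule_single: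
  assumes "sset s \<subseteq> single_strand_cells"
  shows "has_turning_rule (Infinite (smap single s)) t \<longleftrightarrow>
    turning_rule t \<and> (\<forall>i. s !! Suc i = step t (s !! i))"
proof (cases "turning_rule t")
  case True
  have mem: "s !! i \<in> single_strand_cells" for i
    using assms snth_sset by blast
  show ?thesis
    unfolding single_successor_iff[OF mem mem True, symmetric]
    using True by (simp add: has_turning_rule_def continuous_def) blast
qed (simp add: has_turning_rule_def)

text \<open>Advancing a periodic stream by one generation rotates its period by one place. The
  infinite recurrence thus becomes one equation between finite lists, which can be evaluated for a
  concrete \<open>xs\<close>.\<close>

lemma has_turning_rule_omega_single:
  assumes "xs \<noteq> []" "set xs \<subseteq> single_strand_cells"
  shows "has_turning_rule (omega (map single xs)) t \<longleftrightarrow>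
    turning_rule t \<and> rotate1 xs = map (step t) xs"
proof -
  have "sset (cycle xs) \<subseteq> single_strand_cells"
    using assms by simp
  moreover have "(\<forall>i. cycle xs !! Suc i = step t (cycle xs !! i)) \<longleftrightarrow>
      rotate1 xs = map (step t) xs"
  proof
    assume *: "\<forall>i. cycle xs !! Suc i = step t (cycle xs !! i)"
    show "rotate1 xs = map (step t) xs"
    proof (rule nth_equalityI)
      fix i assume "i < length (rotate1 xs)"
      then show "rotate1 xs ! i = map (step t) xs ! i"
        using *[rule_format, of i] assms by (simp add: snth_cycle nth_rotate1)
    qed simp
  next
    assume *: "rotate1 xs = map (step t) xs"
    show "\<forall>i. cycle xs !! Suc i = step t (cycle xs !! i)"
    proof
      fix i
      have "rotate1 xs ! (i mod length xs) = map (step t) xs ! (i mod length xs)"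
        by (simp add: *)
      then show "cycle xs !! Suc i = step t (cycle xs !! i)"
        using assms by (simp add: snth_cycle nth_rotate1 mod_Suc_eq)
    qed
  qed
  ultimately show ?thesis
    using has_turning_rule_single[of "cycle xs" t] assms
    by (simp add: smap_cycle omega_def)
qed

section \<open>Generic turning rules as templates\<close>

definition matches :: "bool list \<Rightarrow> rule_symbol list \<Rightarrow> bool" where
  "matches t r \<longleftrightarrow> list_all2 (\<lambda>b x. x = X \<or> x = (if b then B1 else B0)) t r"

text \<open>When the rules of \<open>g\<close> are exactly the fillings of a template, each
  \<open>X\<close> can be filled in both ways independently of the rest, while every other place is
  constant. The generic rule is then the template itself.\<close>

lemma generic_turning_rule_eqI:
  assumes rules: "\<And>t. has_turning_rule g t \<longleftrightarrow> matches t r" and len: "length r = 9"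
  shows "generic_turning_rule g = r"
proof (rule nth_equalityI)
  show "length (generic_turning_rule g) = length r"
    by (simp add: generic_turning_rule_def len del: upt_rec_numeral)
  fix i assume "i < length (generic_turning_rule g)"
  then have i: "i < 9"
    by (simp add: generic_turning_rule_def del: upt_rec_numeral)
  \<comment> \<open>The filling of \<open>r\<close> that puts \<open>y\<close> in the place of every
    \<open>X\<close>. The two choices of \<open>y\<close> give matching rules that differ at each
    \<open>X\<close>.\<close>
  let ?t = "\<lambda>y. map (\<lambda>x. x = B1 \<or> x = X \<and> y) r"
  have "x = X \<or> x = (if x = B1 \<or> x = X \<and> y then B1 else B0)" for x y
    by (cases x) simp_all
  then have t: "matches (?t y) r" for y
    by (simp add: matches_def list_all2_map1 list_all2_same)
  have nth: "v ! i = (r ! i = B1)" if "matches v r" "r ! i \<noteq> X" for v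
  proof -
    have "r ! i = (if v ! i then B1 else B0)"
      using that i len by (auto simp: matches_def list_all2_conv_all_nth)
    then show ?thesis
      by simp
  qed
  have generic: "generic_turning_rule g ! i =
      (if \<exists>t u. matches t r \<and> matches u r \<and> t ! i \<noteq> u ! i then X
       else if \<forall>t. matches t r \<longrightarrow> t ! i then B1 else B0)"
  proof -
    have "i < length [0..<9]"
      using i by (simp only: length_upt diff_zero)
    moreover have "[0..<9] ! i = i"
      using nth_upt[of 0 i 9] i by (simp only: add_0)
    ultimately show ?thesis
      by (simp only: generic_turning_rule_def rules nth_map)
  qed
  show "generic_turning_rule g ! i = r ! i"
  proof (cases "r ! i = X")
    case True
    have "?t False ! i \<noteq> ?t True ! i"
      using i len True by simp
    then have "\<exists>t u. matches t r \<and> matches u r \<and> t ! i \<noteq> u ! i"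
      by (intro exI[of _ "?t False"] exI[of _ "?t True"] conjI t)
    then show ?thesis
      by (simp only: generic True if_True)
  next
    case False
    then have no_pair: "\<not> (\<exists>t u. matches t r \<and> matches u r \<and> t ! i \<noteq> u ! i)"
      by (simp add: nth)
    \<comment> \<open>The filling \<open>?t True\<close> shows that some rule matches, so the
      universal statement is not vacuously true at a place with \<open>B0\<close>.\<close>
    have all: "(\<forall>t. matches t r \<longrightarrow> t ! i) \<longleftrightarrow> r ! i = B1"
      using nth[OF _ False] t[of True] by auto
    have "generic_turning_rule g ! i = (if r ! i = B1 then B1 else B0)"
      by (simp only: generic no_pair all if_False)
    then show ?thesis
      using False by (cases "r ! i") simp_all
  qed
qed

section \<open>Classification of the cycles of \<open>step\<close>\<close>

definition single_strand_cycles :: "cell list set" where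
  "single_strand_cycles = {[C_sn, C_ns], [C_rn], [C_ns, C_rn, C_sn], [C_nl], [C_sn, C_nl, C_ns],
    [C_sn, C_nl, C_ns, C_rn]}"

text \<open>A finite check: the first cell and the four bits read by \<open>step\<close> determine
  the whole list, and closing up without repetition leaves only rotations of the six cycles.\<close>

lemma step_cycle_rotation:
  assumes "xs \<noteq> []" "distinct xs" "set xs \<subseteq> single_strand_cells"
    and step: "rotate1 xs = map (step t) xs"
  shows "\<exists>k. \<exists>ys\<in>single_strand_cycles. xs = rotate k ys"
proof -
  define P where "P xs \<longleftrightarrow> (\<exists>k. \<exists>ys\<in>single_strand_cycles. xs = rotate k ys)" for xs
  have base: "P ys" if "ys \<in> single_strand_cycles" for ys
    using that unfolding P_def by (intro exI[of _ 0] bexI[of _ ys]) auto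
  have rot: "P (zs @ [z])" if "P (z # zs)" for z zs
    using that unfolding P_def by (metis rotate1.simps(2) rotate_Suc)
  have cycles: "P [C_sn, C_ns]" "P [C_rn]" "P [C_ns, C_rn, C_sn]" "P [C_nl]" "P [C_sn, C_nl, C_ns]"
      "P [C_sn, C_nl, C_ns, C_rn]"
    by (simp_all add: base single_strand_cycles_def)
  \<comment> \<open>As no cycle is longer than four, up to three moves of the head to the end
    produce all its rotations.\<close>
  note rot1 = cycles[THEN rot, simplified]
  note rot2 = rot1[THEN rot, simplified]
  note rot3 = rot2[THEN rot, simplified]
  have "card (set xs) \<le> card single_strand_cells"
    using assms by (intro card_mono) (auto simp: single_strand_cells_def)
  then have "length xs \<le> 4"
    using assms by (simp add: distinct_card single_strand_cells_def)
  then consider a where "xs = [a]" | a b where "xs = [a, b]" | a b c where "xs = [a, b, c]"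
    | a b c d where "xs = [a, b, c, d]"
    using \<open>xs \<noteq> []\<close> by (auto simp: numeral_eq_Suc le_Suc_eq length_Suc_conv)
  then have "P xs"
  proof cases
    case (1 a)
    then have eqs: "step t a = a"
      using step[symmetric] by simp_all
    have "a \<in> single_strand_cells" "distinct [a]"
      using assms(2,3) 1 by simp_all
    then show ?thesis
      using eqs unfolding 1
      by (cases a; cases "t ! 1"; cases "t ! 3"; cases "t ! 5"; cases "t ! 7";
          simp add: single_strand_cells_def cycles)
  next
    case (2 a b)
    then have eqs: "step t a = b" "step t b = a"
      using step[symmetric] by simp_all
    have "a \<in> single_strand_cells" "distinct [a, b]"
      using assms(2,3) 2 by simp_all
    then show ?thesis
      \<comment> \<open>The flipped equation eliminates \<open>b\<close> in favour of
        \<open>a\<close>; the other one remains as the condition that the cycle closes. The longer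
        cases proceed in the same way.\<close>
      using eqs(1)[symmetric] eqs(2) unfolding 2
      by (cases a; cases "t ! 1"; cases "t ! 3"; cases "t ! 5"; cases "t ! 7";
          simp add: single_strand_cells_def cycles rot1)
  next
    case (3 a b c)
    then have eqs: "step t a = b" "step t b = c" "step t c = a"
      using step[symmetric] by simp_all
    have "a \<in> single_strand_cells" "distinct [a, b, c]"
      using assms(2,3) 3 by simp_all
    then show ?thesis
      using eqs(1-2)[symmetric] eqs(3) unfolding 3
      by (cases a; cases "t ! 1"; cases "t ! 3"; cases "t ! 5"; cases "t ! 7";
          simp add: single_strand_cells_def cycles rot1 rot2)
  next
    case (4 a b c d)
    then have eqs: "step t a = b" "step t b = c" "step t c = d" "step t d = a"
      using step[symmetric] by simp_all
    have "a \<in> single_strand_cells" "distinct [a, b, c, d]"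
      using assms(2,3) 4 by simp_all
    then show ?thesis
      using eqs(1-3)[symmetric] eqs(4) unfolding 4
      by (cases a; cases "t ! 1"; cases "t ! 3"; cases "t ! 5"; cases "t ! 7";
          simp add: single_strand_cells_def cycles rot1 rot2 rot3)
  qed
  then show ?thesis
    by (simp add: P_def)
qed

section \<open>Repeating one-strand patterns as distinct cycles\<close>

lemma repeating_iff_is_omega:
  assumes "sca_pattern 1 g"
  shows "repeating_sca_pattern 1 g \<longleftrightarrow> is_omega g"
proof
  assume om: "is_omega g"
  have False if null: "null_chain (per g) ps" for ps
  proof -
    have "g = omega (per g)" "per g \<noteq> []"
      using per_omega om by auto
    then have "per g ! 0 \<in> generations g"
      by (metis generations.simps(2) mod_0 omega_def snth_cycle snth_sset)
    then obtain c where "per g ! 0 = single c"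
      using assms is_generation_1 unfolding sca_pattern_def grid_pattern_def by metis
    then show False
      using null unfolding null_chain_def by (auto simp: single_apply split: if_splits)
  qed
  then show "repeating_sca_pattern 1 g"
    using assms om by (auto simp: repeating_sca_pattern_def)
qed (simp add: repeating_sca_pattern_def)

lemma one_strand_omega_cycle:
  assumes sca: "sca_pattern 1 g" and "is_omega g"
  obtains xs t where "xs \<noteq> []" "distinct xs" "set xs \<subseteq> single_strand_cells"
    "g = omega (map single xs)"
    "rotate1 xs = map (step t) xs"
proof -
  obtain a where a: "a \<noteq> []" "g = omega a"
    using assms by (auto simp: is_omega_def)
  have "\<exists>c. c \<in> single_strand_cells \<and> cycle a !! i = single c" for i
    using sca a is_generation_1[of "cycle a !! i"] snth_sset[of "cycle a" i]
    unfolding sca_pattern_def grid_pattern_def omega_def by (metis generations.simps(2))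
  then obtain c where c: "\<And>i. c i \<in> single_strand_cells" "\<And>i. cycle a !! i = single (c i)"
    by metis
  \<comment> \<open>The cells at position 0, collected into a stream: this is the orbit to which the
    cycle argument applies.\<close>
  define s where "s = smap c nats"
  have s: "s !! i = c i" for i
    by (simp add: s_def)
  have sub: "sset s \<subseteq> single_strand_cells"
    using c by (auto simp: sset_range s)
  have g: "g = Infinite (smap single s)"
    using a c by (simp add: omega_def s) (rule snth_equalityI, simp add: s)
  obtain t where "has_turning_rule g t"
    using sca by (auto simp: sca_pattern_def)
  then have step: "\<And>i. s !! Suc i = step t (s !! i)" and t: "turning_rule t"
    using has_turning_rule_single[OF sub] g by blast+
  \<comment> \<open>Any period, shortest or not, provides a return time; injectivity of
    \<open>single\<close> carries it over to the cells.\<close>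
  have "cycle a !! length a = cycle a !! 0"
    using a by (simp add: snth_cycle)
  then have "s !! length a = s !! 0"
    using inj_single c by (metis injD s)
  then obtain xs where xs: "xs \<noteq> []" "distinct xs" "s = cycle xs"
    using periodic_orbit_distinct_cycle[of s "step t" "length a"] step a by blast
  have "set xs \<subseteq> single_strand_cells"
    using c xs by (metis in_set_conv_nth mod_less s snth_cycle subsetI)
  moreover have "g = omega (map single xs)"
    using g xs by (simp add: omega_def smap_cycle)
  moreover have "rotate1 xs = map (step t) xs"
    using \<open>has_turning_rule g t\<close> calculation has_turning_rule_omega_single xs(1) by blast
  ultimately show thesis
    using that xs by blast
qed

section \<open>Shifts, speeds and generic rules of explicit cycles\<close>

lemma per_omega_single:
  assumes "xs \<noteq> []" "distinct xs"
  shows "per (omega (map single xs)) = map single xs"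
  using assms inj_single by (intro per_omega_distinct) (auto simp: distinct_map inj_on_def dest: injD)

lemma is_shift_of_omega_single:
  assumes "xs \<noteq> []" "distinct xs"
  shows "is_shift_of h (omega (map single xs)) \<longleftrightarrow> (\<exists>k. h = omega (map single (rotate k xs)))"
  using assms by (auto simp: is_shift_of_def per_omega_single is_omega_def rotate_map)

lemma speed_omega_single:
  assumes "xs \<noteq> []" "distinct xs"
  shows "speed (omega (map single xs)) =
    speed_symbol (\<Sum>c\<leftarrow>xs. if c = C_nl then 1 else if c = C_rn then - 1 else 0) (length xs)"
  using assms by (simp add: speed_def per_omega_single comp_def edge_move_def single_apply cong: if_cong)

text \<open>Spelling out the nine bits turns the comparison of rules with the template into a
  propositional statement for each concrete cycle. Lists of any other length are neither turning
  rules nor matches of \<open>r\<close>.\<close>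

lemma generic_turning_rule_omega_single:
  assumes "xs \<noteq> []" "set xs \<subseteq> single_strand_cells" "length r = 9"
    and bits: "\<And>b0 b1 b2 b3 b4 b5 b6 b7 b8.
      let t = [b0, b1, b2, b3, b4, b5, b6, b7, b8]
      in \<not> b4 \<and> rotate1 xs = map (step t) xs \<longleftrightarrow> matches t r"
  shows "generic_turning_rule (omega (map single xs)) = r"
proof (rule generic_turning_rule_eqI)
  fix t
  have "turning_rule t \<and> rotate1 xs = map (step t) xs \<longleftrightarrow> matches t r"
  proof (cases "length t = 9")
    case True
    then obtain b0 b1 b2 b3 b4 b5 b6 b7 b8 where "t = [b0, b1, b2, b3, b4, b5, b6, b7, b8]"
      by (auto simp: numeral_eq_Suc length_Suc_conv)
    then show ?thesis
      using bits[of b0 b1 b2 b3 b4 b5 b6 b7 b8] by (simp add: turning_rule_def Let_def)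
  next
    case False
    then show ?thesis
      using assms(3) by (auto simp: turning_rule_def matches_def dest: list_all2_lengthD)
  qed
  then show "has_turning_rule (omega (map single xs)) t \<longleftrightarrow> matches t r"
    using assms(1,2) by (simp add: has_turning_rule_omega_single)
qed fact

theorem theorem5p1:
  fixes g :: pattern
  assumes "sca_pattern 1 g"
  shows
   "let table =
      [(omega [cells [C_sn], cells [C_ns]],
          Speed_0, [X, B0, X, B0, B0, X, X, X, X]),
       (omega [cells [C_rn]],
          Speed_minus_1, [X, X, X, X, B0, X, X, B1, X]),
       (omega [cells [C_ns], cells [C_rn], cells [C_sn]],
          Frac (- 1) 3, [X, B1, X, B0, B0, X, X, B0, X]),
       (omega [cells [C_nl]],
          Speed_1, [X, X, X, X, B0, B1, X, X, X]),
       (omega [cells [C_sn], cells [C_nl], cells [C_ns]],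
          Frac 1 3, [X, B0, X, B1, B0, B0, X, X, X]),
       (omega [cells [C_sn], cells [C_nl], cells [C_ns], cells [C_rn]],
          Speed_0, [X, B1, X, B1, B0, B0, X, B0, X])]
    in (repeating_sca_pattern 1 g \<longleftrightarrow> (\<exists>(p, v, t)\<in>set table. is_shift_of g p)) \<and>
       (\<forall>(p, v, t)\<in>set table. speed p = v \<and> generic_turning_rule p = t)"
proof -
  let ?pat = "\<lambda>xs. omega (map single xs)"
  have "is_omega g \<longleftrightarrow> (\<exists>ys\<in>single_strand_cycles. is_shift_of g (?pat ys))"
  proof
    assume "is_omega g"
    then obtain xs t where xs: "xs \<noteq> []" "distinct xs" "set xs \<subseteq> single_strand_cells"
      "g = ?pat xs" "rotate1 xs = map (step t) xs"
      using one_strand_omega_cycle assms by blast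
    then obtain k ys where ys: "ys \<in> single_strand_cycles" "xs = rotate k ys"
      using step_cycle_rotation by blast
    \<comment> \<open>Rotation preserves both properties, so \<open>ys\<close> is the shortest
      period of its own pattern and \<open>xs\<close> gives a shift of it.\<close>
    moreover from this have "ys \<noteq> []" "distinct ys"
      using xs by auto
    ultimately show "\<exists>ys\<in>single_strand_cycles. is_shift_of g (?pat ys)"
      using xs(4) by (intro bexI[of _ ys]) (auto simp: is_shift_of_omega_single)
  next
    assume "\<exists>ys\<in>single_strand_cycles. is_shift_of g (?pat ys)"
    \<comment> \<open>A shift repeats a rotation of a nonempty period, and this rotation is itself
      nonempty.\<close>
    then show "is_omega g"
      using per_omega(1) by (metis is_omega_def is_shift_of_def rotate_is_Nil_conv)
  qed
  then have "repeating_sca_pattern 1 g \<longleftrightarrow> (\<exists>ys\<in>single_strand_cycles. is_shift_of g (?pat ys))"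
    using repeating_iff_is_omega[OF assms] by simp
  moreover have
    "speed (?pat [C_sn, C_ns]) = Speed_0"
    "speed (?pat [C_rn]) = Speed_minus_1"
    "speed (?pat [C_ns, C_rn, C_sn]) = Frac (- 1) 3"
    "speed (?pat [C_nl]) = Speed_1"
    "speed (?pat [C_sn, C_nl, C_ns]) = Frac 1 3"
    "speed (?pat [C_sn, C_nl, C_ns, C_rn]) = Speed_0"
    by (subst speed_omega_single; simp add: speed_symbol_def)+
  moreover have
    "generic_turning_rule (?pat [C_sn, C_ns]) = [X, B0, X, B0, B0, X, X, X, X]"
    "generic_turning_rule (?pat [C_rn]) = [X, X, X, X, B0, X, X, B1, X]"
    "generic_turning_rule (?pat [C_ns, C_rn, C_sn]) = [X, B1, X, B0, B0, X, X, B0, X]"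
    "generic_turning_rule (?pat [C_nl]) = [X, X, X, X, B0, B1, X, X, X]"
    "generic_turning_rule (?pat [C_sn, C_nl, C_ns]) = [X, B0, X, B1, B0, B0, X, X, X]"
    "generic_turning_rule (?pat [C_sn, C_nl, C_ns, C_rn]) = [X, B1, X, B1, B0, B0, X, B0, X]"
    by (rule generic_turning_rule_omega_single;
        simp add: single_strand_cells_def matches_def; blast)+
  ultimately show ?thesis
    by (simp add: single_def single_strand_cycles_def)
qed

end
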